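(* Let $X$ be a real Hilbert space, $T:X\rightrightarrows X$ maximal monotone, $\sigma\in[0,1)$, $\underline\lambda>0$, and let $(\lambda_k)_{k\in\mathbb N}$ be a sequence in $[\underline\lambda,\infty)$. Then the sequence of point-to-set maps $\left(J_{\lambda_kT,\sigma}\right)_{k\in\mathbb N}$ satisfies properties P1 and P2 with respect to $\Omega=\{x\in X : 0\in T(x)\}=T^{-1}(0)$.
   Context: A point-to-set map $F:X\rightrightarrows X$ is a function from $X$ to the power set of $X$. For maximal monotone $T:X\rightrightarrows X$ and $\varepsilon\ge 0$, the $\varepsilon$-enlargement of $T$ is $$T^{[\varepsilon]}(x)=\{v\in X : \langle x-y,v-u\rangle\ge-\varepsilon\ \text{ for all } y\in X,\ u\in T(y)\}.$$ For $\sigma\ge 0$, the $\sigma$-approximate resolvent of $T$ is the point-to-set map $J_{T,\sigma}:X\rightrightarrows X$, $$J_{T,\sigma}(x)=\{x-v : \exists\,\varepsilon\ge 0,\ y\in X \text{ with } v\in T^{[\varepsilon]}(y),\ \|v+y-x\|^2+2\varepsilon\le\sigma^2\|y-x\|^2\}.$$ $J_{\lambda T,\sigma}$ denotes the $\sigma$-approximate resolvent of the maximal monotone operator $\lambda T$. Properties of a sequence $(F_n:X\rightrightarrows X)_{n\in\mathbb N}$ with respect to $\Omega\subset X$: P1: if $\hat x\in F_n(x)$ (for some $n$ and $x\in X$) and $x^*\in\Omega$, then $\|x^*-\hat x\|\le\|x^*-x\|$. P2: if $(z_k)_{k\in\mathbb N}$ converges weakly to $\bar z$, $\hat z_k\in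 F_{n_k}(z_k)$ for all $k$ with $n_1<n_2<\cdots$, and for some $x^*\in\Omega$ one has $\lim_{k\to\infty}\left(\|x^*-z_k\|-\|x^*-\hat z_k\|\right)=0$, then $\bar z\in\Omega$. *)

theory Defs
  imports "HOL-Analysis.Analysis"
begin

definition monotone_operator :: "('a::real_inner \<Rightarrow> 'a set) \<Rightarrow> bool" where
  "monotone_operator T \<longleftrightarrow>
     (\<forall>x y. \<forall>u\<in>T x. \<forall>v\<in>T y. inner (x - y) (u - v) \<ge> 0)"

text \<open>Maximality is with respect to inclusion of graphs, i.e. pointwise inclusion of the
  point-to-set maps.\<close>

definition maximal_monotone :: "('a::real_inner \<Rightarrow> 'a set) \<Rightarrow> bool" where
  "maximal_monotone T \<longleftrightarrow> monotone_operator T \<and>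
     (\<forall>S. monotone_operator S \<and> (\<forall>x. T x \<subseteq> S x) \<longrightarrow> S = T)"

definition scale_operator :: "real \<Rightarrow> ('a::real_vector \<Rightarrow> 'a set) \<Rightarrow> 'a \<Rightarrow> 'a set" where
  "scale_operator c T = (\<lambda>x. {c *\<^sub>R u | u. u \<in> T x})"

definition enlargement :: "('a::real_inner \<Rightarrow> 'a set) \<Rightarrow> real \<Rightarrow> 'a \<Rightarrow> 'a set" where
  "enlargement T \<epsilon> x = {v. \<forall>y. \<forall>u\<in>T y. inner (x - y) (v - u) \<ge> - \<epsilon>}"

definition approx_resolvent :: "('a::real_inner \<Rightarrow> 'a set) \<Rightarrow> real \<Rightarrow> 'a \<Rightarrow> 'a set" where
  "approx_resolvent T \<sigma> x = {x - v | v. \<exists>\<epsilon>\<ge>0. \<exists>y. v \<in> enlargement T \<epsilon> y \<and>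
     (norm (v + y - x))\<^sup>2 + 2 * \<epsilon> \<le> \<sigma>\<^sup>2 * (norm (y - x))\<^sup>2}"

definition weakly_converges :: "(nat \<Rightarrow> 'a::real_normed_vector) \<Rightarrow> 'a \<Rightarrow> bool" where
  "weakly_converges z l \<longleftrightarrow>
     (\<forall>f :: 'a \<Rightarrow> real. bounded_linear f \<longrightarrow> (\<lambda>k. f (z k)) \<longlonglongrightarrow> f l)"

definition property_P1 :: "(nat \<Rightarrow> 'a::real_normed_vector \<Rightarrow> 'a set) \<Rightarrow> 'a set \<Rightarrow> bool" where
  "property_P1 F \<Omega> \<longleftrightarrow>
     (\<forall>n x xhat xs. xhat \<in> F n x \<and> xs \<in> \<Omega> \<longrightarrow> norm (xs - xhat) \<le> norm (xs - x))"

definition property_P2 :: "(nat \<Rightarrow> 'a::real_normed_vector \<Rightarrow> 'a set) \<Rightarrow> 'a set \<Rightarrow> bool" where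
  "property_P2 F \<Omega> \<longleftrightarrow>
     (\<forall>z zbar zhat n. weakly_converges z zbar \<and> strict_mono n \<and>
        (\<forall>k::nat. zhat k \<in> F (n k) (z k)) \<and>
        (\<exists>xs\<in>\<Omega>. (\<lambda>k. norm (xs - z k) - norm (xs - zhat k)) \<longlonglongrightarrow> 0)
        \<longrightarrow> zbar \<in> \<Omega>)"

end

theory Submission
  imports Defs
begin

text \<open>For \<open>x - v \<in> J(x)\<close> with auxiliary point \<open>y\<close>, polarization together with the
  enlargement inequality at a zero \<open>x\<^sup>*\<close> of \<open>T\<close> gives
  \<open>(1 - \<sigma>\<^sup>2) \<parallel>y - x\<parallel>\<^sup>2 + \<parallel>x\<^sup>* - (x - v)\<parallel>\<^sup>2 \<le> \<parallel>x\<^sup>* - x\<parallel>\<^sup>2\<close>, which is P1.  In the situation of P2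
  the sequence \<open>z\<close> is bounded by the uniform boundedness principle, so this inequality forces
  \<open>y - z\<close>, \<open>v\<close> and \<open>\<epsilon>\<close> to tend to 0.  Then \<open>y\<close> converges weakly to the weak limit of \<open>z\<close>, and
  since the \<open>\<lambda>\<close> are bounded away from 0 one can pass to the limit in the enlargement inequality;
  maximality of \<open>T\<close> concludes.\<close>

text \<open>Uniform boundedness by Baire category: the closed sets \<open>E m\<close> cover the
  complete space, so one of them contains a ball, and a bound on \<open>inner x\<close> over a ball
  of radius \<open>r\<close> bounds \<open>norm x\<close>, uniformly for \<open>x\<close> in
  \<open>A\<close>.\<close>

lemma bounded_if_pointwise_inner_bounded:
  fixes A :: "'a::{real_inner, complete_space} set"
  assumes "\<And>w. bounded ((\<lambda>x. inner x w) ` A)"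
  shows "bounded A"
proof -
  define E :: "nat \<Rightarrow> 'a set" where "E m = {w. \<forall>x\<in>A. \<bar>inner x w\<bar> \<le> real m}" for m
  have closed_E: "closed (E m)" for m
  proof -
    have "E m = (\<Inter>x\<in>A. {w. \<bar>inner x w\<bar> \<le> real m})"
      by (auto simp: E_def)
    then show ?thesis
      by (auto intro!: closed_Collect_le continuous_intros)
  qed
  have cover: "(\<Union>m. E m) = UNIV"
  proof (rule set_eqI, simp)
    fix w
    obtain B where "\<forall>x\<in>A. \<bar>inner x w\<bar> \<le> B"
      using assms[of w] by (auto simp: bounded_iff)
    moreover obtain m where "B \<le> real m"
      using real_arch_simple by blast
    ultimately have "w \<in> E m"
      unfolding E_def by (blast intro: order_trans)
    then show "\<exists>m. w \<in> E m" ..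
  qed
  have "\<exists>m. interior (E m) \<noteq> {}"
  proof (rule ccontr)
    assume "\<not> ?thesis"
    then have "euclidean interior_of \<Union>(range E) = {}"
      using closed_E
      by (intro Baire_category_alt) (auto simp: completely_metrizable_space_euclidean interior_of_def interior_def)
    then show False
      using cover by auto
  qed
  then obtain m w0 where "w0 \<in> interior (E m)"
    by blast
  then obtain r where r: "r > 0" "cball w0 r \<subseteq> E m"
    by (auto simp: mem_interior_cball)
  have "norm x \<le> 2 * real m / r" if "x \<in> A" for x
  proof (cases "x = 0")
    case True
    then show ?thesis using r by simp
  next
    case False
    \<comment> \<open>This is the point of \<open>cball w0 r\<close> reached from \<open>w0\<close>
      in the direction of \<open>x\<close>. There \<open>inner x\<close> exceeds its value at
      \<open>w0\<close> by exactly \<open>r * norm x\<close>, while both values have modulus at most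
      \<open>m\<close>.\<close>
    define w where "w = w0 + (r / norm x) *\<^sub>R x"
    have "w \<in> E m" "w0 \<in> E m"
      using r False by (auto simp: w_def dist_norm subset_iff)
    then have "\<bar>inner x w\<bar> \<le> real m" "\<bar>inner x w0\<bar> \<le> real m"
      using that by (auto simp: E_def)
    moreover have "inner x w = inner x w0 + r * norm x"
      using False by (simp add: w_def inner_add_right dot_square_norm power2_eq_square)
    ultimately have "r * norm x \<le> 2 * real m"
      by linarith
    then show ?thesis
      using r by (simp add: field_simps)
  qed
  then show ?thesis
    by (auto simp: bounded_iff)
qed

lemma weakly_converges_inner:
  fixes z :: "nat \<Rightarrow> 'a::real_inner"
  assumes "weakly_converges z l"
  shows "(\<lambda>k. inner (z k) w) \<longlonglongrightarrow> inner l w"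
  using assms bounded_linear_inner_left by (auto simp: weakly_converges_def)

lemma weakly_converges_imp_bounded:
  fixes z :: "nat \<Rightarrow> 'a::{real_inner, complete_space}"
  assumes "weakly_converges z l"
  shows "bounded (range z)"
proof (rule bounded_if_pointwise_inner_bounded)
  fix w
  have "bounded (range (\<lambda>k. inner (z k) w))"
    using weakly_converges_inner[OF assms] by (rule convergent_imp_bounded)
  then show "bounded ((\<lambda>x. inner x w) ` range z)"
    by (simp add: image_image)
qed

lemma enlargement_scale_operatorD:
  assumes "v \<in> enlargement (scale_operator c T) \<epsilon> y" "u \<in> T w"
  shows "inner (y - w) (v - c *\<^sub>R u) \<ge> - \<epsilon>"
  using assms by (auto simp: enlargement_def scale_operator_def)

lemma approx_resolvent_step:
  assumes v: "v \<in> enlargement S \<epsilon> y" and zero: "0 \<in> S p"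
    and err: "(norm (v + y - x))\<^sup>2 + 2 * \<epsilon> \<le> \<sigma>\<^sup>2 * (norm (y - x))\<^sup>2"
  shows "(1 - \<sigma>\<^sup>2) * (norm (y - x))\<^sup>2 + (norm (p - (x - v)))\<^sup>2 \<le> (norm (p - x))\<^sup>2"
proof -
  have "inner (y - p) v \<ge> - \<epsilon>"
    using v zero by (force simp: enlargement_def)
  \<comment> \<open>The difference
    \<open>(norm (p - (x - v)))\<^sup>2 - (norm (p - x))\<^sup>2\<close> equals \<open>(norm (v + y
    - x))\<^sup>2 - (norm (y - x))\<^sup>2 - 2 * inner (y - p) v\<close>. The last term is at most
    \<open>2 * \<epsilon>\<close>, which is exactly the slack present in \<open>err\<close>.\<close>
  then show ?thesis
    using err unfolding power2_norm_eq_inner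
    by (simp add: inner_simps inner_commute algebra_simps)
qed

text \<open>Adding the pair \<open>(x, v)\<close> to the graph of \<open>T\<close> preserves
  monotonicity, so by maximality the pair was already there.\<close>

lemma maximal_monotone_memI:
  assumes T: "maximal_monotone T"
    and rel: "\<And>w u. u \<in> T w \<Longrightarrow> inner (x - w) (v - u) \<ge> 0"
  shows "v \<in> T x"
proof -
  define S where "S = T(x := insert v (T x))"
  have rel': "inner (w - x) (u - v) \<ge> 0" if "u \<in> T w" for w u
    using rel[OF that] by (metis inner_minus_left inner_minus_right minus_diff_eq minus_minus)
  have "monotone_operator S"
    using T rel rel' unfolding maximal_monotone_def monotone_operator_def S_def
    by (auto split: if_splits)
  then have "S = T"
    using T unfolding maximal_monotone_def S_def by auto
  then show ?thesis
    unfolding S_def by (metis fun_upd_same insertI1)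
qed

theorem theorem4p3:
  fixes T :: "'a::{real_inner, complete_space} \<Rightarrow> 'a set"
    and \<sigma> lam_min :: real
    and lam :: "nat \<Rightarrow> real"
  assumes "maximal_monotone T"
    and "0 \<le> \<sigma>" and "\<sigma> < 1"
    and "lam_min > 0"
    and "\<And>k. lam k \<ge> lam_min"
  shows "property_P1 (\<lambda>k. approx_resolvent (scale_operator (lam k) T) \<sigma>) {x. 0 \<in> T x}
       \<and> property_P2 (\<lambda>k. approx_resolvent (scale_operator (lam k) T) \<sigma>) {x. 0 \<in> T x}"
proof
  have \<sigma>: "\<sigma>\<^sup>2 < 1"
    using assms(2,3) by (simp add: power_less_one_iff abs_square_less_1)
  have scale_zero: "0 \<in> scale_operator c T p" if "0 \<in> T p" for c p
    using that by (force simp: scale_operator_def)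
  show "property_P1 (\<lambda>k. approx_resolvent (scale_operator (lam k) T) \<sigma>) {x. 0 \<in> T x}"
    unfolding property_P1_def
  proof (intro allI impI, elim conjE)
    fix n x xhat p
    assume "xhat \<in> approx_resolvent (scale_operator (lam n) T) \<sigma> x" and p: "p \<in> {x. 0 \<in> T x}"
    then obtain v \<epsilon> y where "xhat = x - v" "v \<in> enlargement (scale_operator (lam n) T) \<epsilon> y"
      "(norm (v + y - x))\<^sup>2 + 2 * \<epsilon> \<le> \<sigma>\<^sup>2 * (norm (y - x))\<^sup>2"
      by (auto simp: approx_resolvent_def)
    then have "(1 - \<sigma>\<^sup>2) * (norm (y - x))\<^sup>2 + (norm (p - xhat))\<^sup>2 \<le> (norm (p - x))\<^sup>2"
      using approx_resolvent_step scale_zero p by blast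
    moreover have "(1 - \<sigma>\<^sup>2) * (norm (y - x))\<^sup>2 \<ge> 0"
      using \<sigma> by simp
    ultimately have "(norm (p - xhat))\<^sup>2 \<le> (norm (p - x))\<^sup>2"
      by linarith
    then show "norm (p - xhat) \<le> norm (p - x)"
      by (rule power2_le_imp_le) simp
  qed
  show "property_P2 (\<lambda>k. approx_resolvent (scale_operator (lam k) T) \<sigma>) {x. 0 \<in> T x}"
    unfolding property_P2_def
  proof (intro allI impI, elim conjE bexE)
    fix z zbar zhat n p
    assume weak: "weakly_converges z zbar"
      and zhat: "\<forall>k. zhat k \<in> approx_resolvent (scale_operator (lam (n k)) T) \<sigma> (z k)"
      and p: "p \<in> {x. 0 \<in> T x}"
      and lim: "(\<lambda>k. norm (p - z k) - norm (p - zhat k)) \<longlonglongrightarrow> 0"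
    define c where "c k = lam (n k)" for k
    have c: "c k \<ge> lam_min" "c k > 0" for k
      using assms(4) assms(5)[of "n k"] by (auto simp: c_def)
    have "\<forall>k. \<exists>v \<epsilon> y. zhat k = z k - v \<and> \<epsilon> \<ge> 0 \<and> v \<in> enlargement (scale_operator (c k) T) \<epsilon> y \<and>
        (norm (v + y - z k))\<^sup>2 + 2 * \<epsilon> \<le> \<sigma>\<^sup>2 * (norm (y - z k))\<^sup>2"
      using zhat by (auto simp: approx_resolvent_def c_def)
    then obtain v \<epsilon> y where zv: "\<And>k. zhat k = z k - v k" and \<epsilon>: "\<And>k. \<epsilon> k \<ge> 0"
      and v: "\<And>k. v k \<in> enlargement (scale_operator (c k) T) (\<epsilon> k) (y k)"
      and err: "\<And>k. (norm (v k + y k - z k))\<^sup>2 + 2 * \<epsilon> k \<le> \<sigma>\<^sup>2 * (norm (y k - z k))\<^sup>2"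
      by metis
    have step: "(1 - \<sigma>\<^sup>2) * (norm (y k - z k))\<^sup>2 \<le> (norm (p - z k))\<^sup>2 - (norm (p - zhat k))\<^sup>2" for k
      using approx_resolvent_step[OF v _ err] scale_zero p zv by (smt (verit) mem_Collect_eq)

    have z_bdd: "Bseq z"
      using weakly_converges_imp_bounded[OF weak] by (simp add: Bseq_eq_bounded)
    then obtain M where M: "\<And>k. norm (z k) \<le> M"
      by (auto simp: Bseq_def)
    have sq_lim: "(\<lambda>k. (norm (y k - z k))\<^sup>2) \<longlonglongrightarrow> 0"
    proof (rule tendsto_sandwich[OF _ _ tendsto_const])
      let ?d = "\<lambda>k. norm (p - z k) - norm (p - zhat k)"
      \<comment> \<open>Factor the difference of squares in \<open>step\<close> as
        \<open>?d k\<close> times the sum of the two norms. That sum is at most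
        \<open>2 * (norm p + M)\<close>, because \<open>z\<close> is bounded by \<open>M\<close> and
        \<open>?d k\<close> is nonnegative. Dividing by \<open>1 - \<sigma>\<^sup>2\<close> gives
        \<open>?R\<close>.\<close>
      let ?R = "2 * (norm p + M) / (1 - \<sigma>\<^sup>2)"
      show "\<forall>\<^sub>F k in sequentially. 0 \<le> (norm (y k - z k))\<^sup>2"
        by simp
      show "(\<lambda>k. ?R * ?d k) \<longlonglongrightarrow> 0"
        using lim by (rule tendsto_mult_right_zero)
      have "(norm (y k - z k))\<^sup>2 \<le> ?R * ?d k" for k
      proof -
        have "0 \<le> (norm (p - z k))\<^sup>2 - (norm (p - zhat k))\<^sup>2"
          using step[of k] \<sigma> by (smt (verit) mult_nonneg_nonneg zero_le_power2)
        then have d: "?d k \<ge> 0"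
          using power2_le_imp_le[of "norm (p - zhat k)" "norm (p - z k)"] by simp
        have "norm (p - z k) \<le> norm p + M"
          using norm_triangle_ineq4[of p "z k"] M[of k] by linarith
        then have "norm (p - z k) + norm (p - zhat k) \<le> 2 * (norm p + M)"
          using d by (smt (verit))
        then have "?d k * (norm (p - z k) + norm (p - zhat k)) \<le> ?d k * (2 * (norm p + M))"
          using d by (rule mult_left_mono)
        then have "(1 - \<sigma>\<^sup>2) * (norm (y k - z k))\<^sup>2 \<le> 2 * (norm p + M) * ?d k"
          using step[of k] by (simp add: power2_eq_square algebra_simps)
        then show ?thesis
          using \<sigma> by (simp add: field_simps)
      qed
      then show "\<forall>\<^sub>F k in sequentially. (norm (y k - z k))\<^sup>2 \<le> ?R * ?d k"
        by simp
    qed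
    have yz: "(\<lambda>k. y k - z k) \<longlonglongrightarrow> 0"
      using tendsto_real_sqrt[OF sq_lim] by (simp add: tendsto_norm_zero_iff)
    have rhs_lim: "(\<lambda>k. \<sigma>\<^sup>2 * (norm (y k - z k))\<^sup>2) \<longlonglongrightarrow> 0"
      using sq_lim by (rule tendsto_mult_right_zero)
    \<comment> \<open>The two terms on the left of \<open>err\<close> are nonnegative, so each
      vanishes with the right-hand side. Subtracting \<open>y k - z k\<close> from the residual then
      leaves \<open>v k\<close>.\<close>
    have "(\<lambda>k. (norm (v k + y k - z k))\<^sup>2) \<longlonglongrightarrow> 0"
    proof (rule tendsto_sandwich[OF _ _ tendsto_const rhs_lim])
      show "\<forall>\<^sub>F k in sequentially. (norm (v k + y k - z k))\<^sup>2 \<le> \<sigma>\<^sup>2 * (norm (y k - z k))\<^sup>2"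
        using err \<epsilon> by (intro always_eventually allI) (smt (verit))
    qed simp
    from tendsto_real_sqrt[OF this] have "(\<lambda>k. v k + y k - z k) \<longlonglongrightarrow> 0"
      by (simp add: tendsto_norm_zero_iff)
    from tendsto_diff[OF this yz] have v_lim: "v \<longlonglongrightarrow> 0"
      by simp
    have \<epsilon>_lim: "\<epsilon> \<longlonglongrightarrow> 0"
    proof (rule tendsto_sandwich[OF _ _ tendsto_const rhs_lim])
      have "\<epsilon> k \<le> \<sigma>\<^sup>2 * (norm (y k - z k))\<^sup>2" for k
        using err[of k] \<epsilon>[of k] zero_le_power2[of "norm (v k + y k - z k)"] by linarith
      then show "\<forall>\<^sub>F k in sequentially. \<epsilon> k \<le> \<sigma>\<^sup>2 * (norm (y k - z k))\<^sup>2"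
        by simp
    qed (use \<epsilon> in simp)
    \<comment> \<open>The \<open>c k\<close> may be unbounded, so the limit is taken after dividing
      the enlargement inequality by \<open>c k\<close>. The lower bound \<open>lam_min\<close> keeps
      \<open>v k\<close> and \<open>\<epsilon> k\<close> null after this division.\<close>
    have inv_c: "Bseq (\<lambda>k. inverse (c k))"
    proof (rule BseqI')
      show "norm (inverse (c k)) \<le> inverse lam_min" for k
        using c[of k] assms(4) by (simp add: le_imp_inverse_le)
    qed
    have v_scaled: "(\<lambda>k. inverse (c k) *\<^sub>R v k) \<longlonglongrightarrow> 0"
      using bounded_bilinear.Bfun_prod_Zfun[OF bounded_bilinear_scaleR inv_c] v_lim
      by (simp add: tendsto_Zfun_iff)
    have \<epsilon>_scaled: "(\<lambda>k. inverse (c k) * \<epsilon> k) \<longlonglongrightarrow> 0"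
      using bounded_bilinear.Bfun_prod_Zfun[OF bounded_bilinear_mult inv_c] \<epsilon>_lim
      by (simp add: tendsto_Zfun_iff)

    have "0 \<in> T zbar"
    proof (rule maximal_monotone_memI[OF assms(1)])
      fix w u
      assume u: "u \<in> T w"
      \<comment> \<open>The points \<open>y k\<close> are only known to converge weakly, so the
        pairing with the scaled \<open>v k\<close> is treated as a bounded sequence against a
        norm-null one.\<close>
      have yw: "Bseq (\<lambda>k. y k - w)"
      proof -
        have "bounded (range (\<lambda>k. (y k - z k) + (z k - w)))"
          using weakly_converges_imp_bounded[OF weak]
          by (intro bounded_plus_comp[OF convergent_imp_bounded[OF yz]] bounded_minus_comp) auto
        then show ?thesis by (simp add: Bseq_eq_bounded)
      qed
      have "(\<lambda>k. inner (y k - w) (inverse (c k) *\<^sub>R v k)) \<longlonglongrightarrow> 0"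
        using bounded_bilinear.Bfun_prod_Zfun[OF bounded_bilinear_inner yw] v_scaled
        unfolding tendsto_Zfun_iff diff_zero by blast
      \<comment> \<open>Splitting \<open>y k\<close> into \<open>y k - z k\<close> and
        \<open>z k\<close> separates a norm-null part from a weakly convergent one, both paired with
        the fixed vector \<open>u\<close>.\<close>
      moreover have "(\<lambda>k. inner (y k - z k) u + inner (z k) u - inner w u)
          \<longlonglongrightarrow> inner 0 u + inner zbar u - inner w u"
        by (intro tendsto_intros yz weakly_converges_inner[OF weak])
      ultimately have "(\<lambda>k. inner (y k - w) (inverse (c k) *\<^sub>R v k)
            - (inner (y k - z k) u + inner (z k) u - inner w u) + inverse (c k) * \<epsilon> k)
          \<longlonglongrightarrow> 0 - (inner 0 u + inner zbar u - inner w u) + 0"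
        using \<epsilon>_scaled by (intro tendsto_add[OF tendsto_diff])
      moreover have "0 \<le> inner (y k - w) (inverse (c k) *\<^sub>R v k)
            - (inner (y k - z k) u + inner (z k) u - inner w u) + inverse (c k) * \<epsilon> k" for k
      proof -
        have "0 \<le> inverse (c k) * (inner (y k - w) (v k - c k *\<^sub>R u) + \<epsilon> k)"
          using enlargement_scale_operatorD[OF v[of k] u] c(2)[of k] by simp
        also have "\<dots> = inner (y k - w) (inverse (c k) *\<^sub>R v k) - inner (y k - w) u
            + inverse (c k) * \<epsilon> k"
          using c(2)[of k] by (simp add: inner_diff_right field_simps)
        finally show ?thesis
          by (simp add: inner_diff_left)
      qed
      ultimately have "0 \<le> 0 - (inner 0 u + inner zbar u - inner w u) + 0"
        by (intro LIMSEQ_le_const) auto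
      then show "inner (zbar - w) (0 - u) \<ge> 0"
        by (simp add: inner_simps)
    qed
    then show "zbar \<in> {x. 0 \<in> T x}"
      by simp
  qed
qed

end
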